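(* Let $N\geq 1$ and $M:=2^{\sigma_N}$. The set $\mathcal{U}_N$ is periodic with period $M$, i.e., $$x\in\mathcal{U}_N\iff x+M\in\mathcal{U}_N\qquad(x\in\mathbb{Z}_{\geq2}).$$
   Context: Let $\kappa(n)=\lfloor n\log_2 3\rfloor$ for $n\ge1$ and $\sigma_n=\lfloor 1+(n+1)\log_2 3\rfloor=\kappa(n+1)+1$. For $n\ge1$ let $\mathcal{A}_n$ be the set of integer vectors $\boldsymbol{\alpha}=(\alpha_1,\ldots,\alpha_{n+1})$ with $0=\alpha_1<\cdots<\alpha_{n+1}$ and $\alpha_{i+1}\le\kappa(i)$ for $1\le i\le n$. Let $T:\mathbb{Z}\to\mathbb{Z}$ be $T(x)=x/2$ for even $x$ and $T(x)=(3x+1)/2$ for odd $x$. The parity vector of length $L$ of an integer $x$ has entry $1$ at position $s$ ($0\le s\le L-1$) iff $T^s(x)$ is odd; it depends only on $x$ mod $2^L$ and gives a bijection $\mathbb{Z}/2^L\mathbb{Z}\to\{0,1\}^L$. For $\boldsymbol{\alpha}\in\mathcal{A}_n$ let $c(\boldsymbol{\alpha})$ be the unique element of $\{1,\ldots,2^{\sigma_n}-1\}$ whose parity vector of length $\sigma_n$ has ones precisely at positions $\alpha_1,\ldots,\alpha_{n+1}$; put $\mathcal{C}_n=\{c(\boldsymbol{\alpha}):\boldsymbol{\alpha}\in\mathcal{A}_n\}$. For $N\ge1$ the coverage set of order $N$ is the set $\mathcal{U}_N$ of all integers $x\ge2$ such that $x\equiv0\pmod2$, or $x\equiv1\pmod4$,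 or $x\equiv a\pmod{2^{\sigma_n}}$ for some $1\le n\le N$ and some $a\in\mathcal{C}_n$. *)

theory Defs
  imports Complex_Main "HOL-Number_Theory.Cong"
begin

definition kappa :: "nat \<Rightarrow> int" where
  "kappa n = \<lfloor>real n * log 2 3\<rfloor>"

text \<open>The floor is positive; \<open>nat\<close> only makes it usable as an exponent and a length.\<close>

definition sigma :: "nat \<Rightarrow> nat" where
  "sigma n = nat \<lfloor>1 + (real n + 1) * log 2 3\<rfloor>"

lemma int_sigma: "int (sigma n) = kappa (n + 1) + 1"
proof -
  have "0 \<le> (real n + 1) * log 2 3"
    by simp
  then show ?thesis
    by (simp add: sigma_def kappa_def add.commute)
qed

text \<open>
  A vector \<open>(\<alpha>\<^sub>1, \<dots>, \<alpha>\<^sub>n\<^sub>+\<^sub>1)\<close> is a list of length \<open>n + 1\<close>; lists are indexed from \<open>0\<close>,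
  so \<open>\<alpha> ! i\<close> is the component with index \<open>i + 1\<close>.
\<close>

definition admissible_vectors :: "nat \<Rightarrow> int list set" where
  "admissible_vectors n =
    {\<alpha>. length \<alpha> = n + 1 \<and> \<alpha> ! 0 = 0 \<and> sorted_wrt (<) \<alpha> \<and>
        (\<forall>i\<in>{1..n}. \<alpha> ! i \<le> kappa i)}"

definition collatz :: "int \<Rightarrow> int" where
  "collatz x = (if even x then x div 2 else (3 * x + 1) div 2)"

definition parity_vector :: "nat \<Rightarrow> int \<Rightarrow> nat list" where
  "parity_vector L x = map (\<lambda>s. if odd ((collatz ^^ s) x) then 1 else 0) [0..<L]"

definition ones :: "nat list \<Rightarrow> nat set" where
  "ones v = {s. s < length v \<and> v ! s = 1}"

text \<open>
  The description is meaningful for \<open>\<alpha> \<in> admissible_vectors n\<close>: all components of \<open>\<alpha>\<close> are below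
  \<open>sigma n\<close>, parity vectors of length \<open>L\<close> correspond bijectively to residues modulo \<open>2 ^ L\<close>,
  and the residue \<open>0\<close> is excluded because position \<open>0\<close> carries a one.
\<close>

definition residue_rep :: "nat \<Rightarrow> int list \<Rightarrow> int" where
  "residue_rep n \<alpha> =
    (THE c. c \<in> {1..2 ^ sigma n - 1} \<and> int ` ones (parity_vector (sigma n) c) = set \<alpha>)"

definition residue_reps :: "nat \<Rightarrow> int set" where
  "residue_reps n = residue_rep n ` admissible_vectors n"

definition coverage_set :: "nat \<Rightarrow> int set" where
  "coverage_set N =
    {x. x \<ge> 2 \<and>
        ([x = 0] (mod 2) \<or> [x = 1] (mod 4) \<or>
         (\<exists>n\<in>{1..N}. \<exists>a\<in>residue_reps n. [x = a] (mod 2 ^ sigma n)))}"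

end

theory Submission
  imports Defs
begin

text \<open>
  The coverage set of order \<open>N\<close> is cut out of the integers \<open>\<ge> 2\<close> by congruences modulo \<open>2\<close>, \<open>4\<close> and
  \<open>2 ^ sigma n\<close> with \<open>1 \<le> n \<le> N\<close>. Since \<open>sigma\<close> is increasing and at least \<open>2\<close>, all these moduli
  divide \<open>2 ^ sigma N\<close>, so a shift by \<open>2 ^ sigma N\<close> changes none of the residues involved. As the
  shift is positive, it also preserves the condition \<open>x \<ge> 2\<close>.
\<close>

lemma mono_sigma: "mono sigma"
  unfolding sigma_def
  by (intro monoI nat_mono floor_mono add_left_mono mult_right_mono) auto

lemma sigma_ge_2: "2 \<le> sigma n"
proof -
  have "1 \<le> log 2 (3 :: real)"
    by simp
  then have "1 * 1 \<le> (real n + 1) * log 2 3"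
    by (intro mult_mono) auto
  then have "2 \<le> \<lfloor>1 + (real n + 1) * log 2 3\<rfloor>"
    by (simp add: le_floor_iff)
  then show ?thesis
    unfolding sigma_def by linarith
qed

lemma cong_add_multiple_left_iff:
  fixes x a m M :: int
  assumes "m dvd M"
  shows "[x + M = a] (mod m) \<longleftrightarrow> [x = a] (mod m)"
  using assms by (auto simp: cong_def mod_add_eq elim!: dvdE)

theorem lemma24:
  fixes N :: nat and M :: int
  assumes "N \<ge> 1" and "M = 2 ^ sigma N"
  shows "\<forall>x\<ge>2. x \<in> coverage_set N \<longleftrightarrow> x + M \<in> coverage_set N"
proof (intro allI impI)
  fix x :: int
  assume "2 \<le> x"
  moreover have "0 < M"
    using assms(2) by simp
  ultimately have "2 \<le> x + M"
    by simp
  have power_dvd: "2 ^ k dvd M" if "k \<le> sigma N" for k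
    using that assms(2) by (simp add: le_imp_power_dvd)
  have "2 dvd M" and "4 dvd M"
    using power_dvd[of 1] power_dvd[of 2] sigma_ge_2[of N] by auto
  then have "[x + M = 0] (mod 2) \<longleftrightarrow> [x = 0] (mod 2)"
    and "[x + M = 1] (mod 4) \<longleftrightarrow> [x = 1] (mod 4)"
    by (simp_all only: cong_add_multiple_left_iff)
  moreover have "[x + M = a] (mod 2 ^ sigma n) \<longleftrightarrow> [x = a] (mod 2 ^ sigma n)"
    if "n \<in> {1..N}" for n a
    using that
    by (intro cong_add_multiple_left_iff power_dvd monoD[OF mono_sigma]) simp
  ultimately show "x \<in> coverage_set N \<longleftrightarrow> x + M \<in> coverage_set N"
    using \<open>2 \<le> x\<close> \<open>2 \<le> x + M\<close> unfolding coverage_set_def by blast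
qed

end
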